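(* Let $\{\mathbf{v}^k\}\subset\mathbb{R}^d$ and $\{\mathbf{u}^k\}\subset\mathbb{R}^p$ be random nonnegative vector sequences, and let $\{a^k\}$ and $\{b^k\}$ be random nonnegative scalar sequences such that $$\mathbb{E}[\mathbf{v}^{k+1}\mid\mathcal{F}^k]\le(V^k+a^k\mathbf{1}\mathbf{1}^T)\mathbf{v}^k+b^k\mathbf{1}-H^k\mathbf{u}^k,\quad\forall k\ge0$$ holds almost surely, where $\{V^k\}$ and $\{H^k\}$ are random sequences of nonnegative matrices and $\mathbb{E}[\mathbf{v}^{k+1}\mid\mathcal{F}^k]$ denotes the conditional expectation given $\mathbf{v}^\ell,\mathbf{u}^\ell,a^\ell,b^\ell,V^\ell,H^\ell$ for $\ell=0,1,\dots,k$. Assume that $\sum_{k=0}^\infty a^k<\infty$ and $\sum_{k=0}^\infty b^k<\infty$ almost surely, and that there exists a deterministic vector $\pi>0$ such that $\pi^TV^k\le\pi^T$ and $\pi^TH^k\ge0$ hold almost surely for all $k\ge0$. Then: 1) $\{\pi^T\mathbf{v}^k\}$ converges almost surely to some random variable $\pi^T\mathbf{v}\ge0$; 2) $\{\mathbf{v}^k\}$ is bounded almost surely; 3) $\sum_{k=0}^\infty\pi^TH^k\mathbf{u}^k<\infty$ holds almost surely.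
   Context: Vector inequalities are entrywise; a nonnegative vector or matrix has nonnegative entries and $\pi>0$ means that all entries of $\pi$ are positive. $\mathbf{1}$ is the all-ones vector in $\mathbb{R}^d$; $V^k\in\mathbb{R}^{d\times d}$ and $H^k\in\mathbb{R}^{d\times p}$. *)

theory Defs
  imports "HOL-Probability.Probability"
begin

definition natural_filtration ::
  "'w measure \<Rightarrow> (nat \<Rightarrow> 'w \<Rightarrow> 'b::topological_space) \<Rightarrow> nat \<Rightarrow> 'w measure" where
  "natural_filtration M X k =
     sigma (space M) (\<Union>l\<le>k. {X l -` A \<inter> space M | A. A \<in> sets borel})"

text \<open>
  Entrywise conditional expectation of a nonnegative random vector. No integrability is presumed, so
  the entries live in the extended reals. The library's \<^const>\<open>real_cond_exp\<close> is not used because it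
  takes the value 0 where the conditional expectation of a nonnegative variable is infinite. The type
  is \<^typ>\<open>ereal\<close> rather than \<^typ>\<open>ennreal\<close> so that the entries can be compared with real
  numbers that are not known to be nonnegative (\<^const>\<open>ennreal\<close> would truncate these to 0).
\<close>

definition nonneg_cond_exp_vec ::
  "'w measure \<Rightarrow> 'w measure \<Rightarrow> ('w \<Rightarrow> real ^ 'n) \<Rightarrow> 'w \<Rightarrow> ereal ^ 'n" where
  "nonneg_cond_exp_vec M F X \<omega> =
     (\<chi> i. enn2ereal (nn_cond_exp M F (\<lambda>\<omega>'. ennreal (X \<omega>' $ i)) \<omega>))"

end

theory Submission
  imports Defs
begin

text \<open>
  Put \<open>y k = \<pi> \<bullet> v k\<close>, \<open>s = \<Sum>i. \<pi> $ i\<close> and let \<open>m\<close> be the least entry of \<open>\<pi>\<close>. Multiplying the hypothesis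
  by \<open>\<pi>\<close> gives the Robbins-Siegmund inequality
  \<open>E[y (k+1) | F k] \<le> (1 + (s / m) * a k) * y k + s * b k - \<pi> \<bullet> (H k *v u k)\<close>.
  Dividing by \<open>\<Prod>j<k. 1 + (s / m) * a j\<close>, adding the rescaled losses, subtracting the rescaled gains
  and killing the process when the gains exceed a level \<open>n\<close> yields a nonnegative supermartingale,
  which converges. For \<open>n\<close> large (depending on the path) the killing never happens, hence the
  losses are summable and \<open>y\<close> converges.

  Convergence of nonnegative supermartingales is Dubins' argument: reinvesting all capital from below
  \<open>a\<close> to above \<open>b\<close> multiplies it by at least \<open>b / a\<close> at every upcrossing while its expectation stays
  at most 1, so \<open>N\<close> upcrossings have probability at most \<open>(a / b) ^ N\<close>.
\<close>

subsection \<open>Nonnegative supermartingales\<close>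

locale filtered_prob_space = prob_space M for M :: "'w measure" +
  fixes F :: "nat \<Rightarrow> 'w measure"
  assumes subalg: "subalgebra M (F k)"
    and sets_F_Suc: "sets (F k) \<subseteq> sets (F (Suc k))"
begin

lemma measurable_F_M: "f \<in> measurable (F k) N \<Longrightarrow> f \<in> measurable M N"
  using measurable_from_subalg[OF subalg] .

lemma measurable_F_Suc:
  assumes "f \<in> measurable (F k) N"
  shows "f \<in> measurable (F (Suc k)) N"
proof -
  have "subalgebra (F (Suc k)) (F k)"
    using sets_F_Suc subalg by (simp add: subalgebra_def)
  then show ?thesis
    using assms by (rule measurable_from_subalg)
qed

lemma measurable_F_mono: "f \<in> measurable (F j) N \<Longrightarrow> j \<le> k \<Longrightarrow> f \<in> measurable (F k) N"
  by (induction k) (auto simp: le_Suc_eq intro: measurable_F_Suc)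

text \<open>Testing against the nonnegative functions measurable at time \<open>k\<close> replaces the conditional
  expectation, so no integrability is needed.\<close>

definition nn_supermartingale :: "(nat \<Rightarrow> 'w \<Rightarrow> ennreal) \<Rightarrow> bool" where
  "nn_supermartingale S \<longleftrightarrow> (\<forall>k. S k \<in> borel_measurable (F k)) \<and>
     (\<forall>k. \<forall>f\<in>borel_measurable (F k).
        (\<integral>\<^sup>+\<omega>. f \<omega> * S (Suc k) \<omega> \<partial>M) \<le> (\<integral>\<^sup>+\<omega>. f \<omega> * S k \<omega> \<partial>M))"

end

text \<open>Upcrossings are counted as the sales of a gambler who buys below \<open>a\<close> and sells above \<open>b\<close>. He
  stops after \<open>N\<close> sales because capital invested again could drop below \<open>(b / a) ^ N\<close>.\<close>

fun trade :: "ennreal \<Rightarrow> ennreal \<Rightarrow> nat \<Rightarrow> bool \<times> nat \<Rightarrow> ennreal \<Rightarrow> bool \<times> nat" where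
  "trade a b N (held, m) x =
     (if held then (if b < x then (False, Suc m) else (True, m)) else (x < a \<and> m < N, m))"

primrec trades :: "ennreal \<Rightarrow> ennreal \<Rightarrow> nat \<Rightarrow> (nat \<Rightarrow> ennreal) \<Rightarrow> nat \<Rightarrow> bool \<times> nat" where
  "trades a b N s 0 = trade a b N (False, 0) (s 0)"
| "trades a b N s (Suc k) = trade a b N (trades a b N s k) (s (Suc k))"

text \<open>The capital, starting from 1 and reinvested at every purchase as if the price were \<open>a\<close>, is
  an affine function of the current price with coefficients depending on the state.\<close>

fun asset_coeff :: "ennreal \<Rightarrow> ennreal \<Rightarrow> bool \<times> nat \<Rightarrow> ennreal" where
  "asset_coeff a b (held, m) = (if held then (b / a) ^ m / a else 0)"

fun cash_coeff :: "ennreal \<Rightarrow> ennreal \<Rightarrow> bool \<times> nat \<Rightarrow> ennreal" where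
  "cash_coeff a b (held, m) = (if held then 0 else (b / a) ^ m)"

definition capital :: "ennreal \<Rightarrow> ennreal \<Rightarrow> bool \<times> nat \<Rightarrow> ennreal \<Rightarrow> ennreal" where
  "capital a b st x = asset_coeff a b st * x + cash_coeff a b st"

text \<open>Trades are booked at the worse price: a sale credits only \<open>b\<close> per share
  although the price exceeds \<open>b\<close>, and a purchase is charged \<open>a\<close> although
  the price is below \<open>a\<close>. Otherwise the state, and with it the capital, is
  unchanged.\<close>

lemma capital_trade_le:
  assumes "0 < a" "a < \<top>"
  shows "capital a b (trade a b N st x) x \<le> capital a b st x"
proof (cases st)
  case (Pair held m)
  have sell: "(b / a) ^ Suc m \<le> (b / a) ^ m / a * x" if "b < x"
  proof -
    have "(b / a) ^ Suc m = (b / a) ^ m / a * b"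
      by (simp add: divide_ennreal_def mult_ac)
    also have "\<dots> \<le> (b / a) ^ m / a * x"
      using that by (intro mult_left_mono) auto
    finally show ?thesis .
  qed
  have buy: "(b / a) ^ m / a * x \<le> (b / a) ^ m" if "x < a"
  proof -
    have "(b / a) ^ m / a * x \<le> (b / a) ^ m / a * a"
      using that by (intro mult_left_mono) auto
    also have "\<dots> = (b / a) ^ m"
      using assms by (simp add: ennreal_divide_times mult_divide_eq_ennreal)
    finally show ?thesis .
  qed
  show ?thesis
    using sell buy by (simp add: Pair capital_def)
qed

text \<open>A purchase requires fewer than \<open>N\<close> sales, and the count stays fixed while
  holding. Hence after \<open>N\<close> sales the capital is pure cash.\<close>

lemma trades_held: "fst (trades a b N s k) \<Longrightarrow> snd (trades a b N s k) < N"
proof (induction k)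
  case (Suc k)
  then show ?case
    by (cases "trades a b N s k") (auto split: if_splits)
qed simp

lemma snd_trades_Suc: "snd (trades a b N s k) \<le> snd (trades a b N s (Suc k))"
  by (cases "trades a b N s k") auto

lemma snd_trades_mono: "j \<le> k \<Longrightarrow> snd (trades a b N s j) \<le> snd (trades a b N s k)"
  by (rule lift_Suc_mono_le[of "\<lambda>k. snd (trades a b N s k)"]) (rule snd_trades_Suc)

text \<open>Were the count stuck at some \<open>j < N\<close>, a later price below \<open>a\<close>
  would leave the gambler holding, and the next price above \<open>b\<close> would force one more
  sale.\<close>

lemma trades_complete:
  assumes low: "\<exists>\<^sub>\<infinity>k. s k < a" and high: "\<exists>\<^sub>\<infinity>k. b < s k"
  shows "\<exists>k. N \<le> snd (trades a b N s k)"
proof -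
  let ?t = "trades a b N s"
  have "\<exists>k. j \<le> snd (?t k)" if "j \<le> N" for j
    using that
  proof (induction j)
    case (Suc j)
    then obtain k where k: "j \<le> snd (?t k)" by auto
    show ?case
    proof (rule ccontr)
      assume "\<nexists>k. Suc j \<le> snd (?t k)"
      then have less: "snd (?t i) \<le> j" for i
        by (metis not_less_eq_eq)
      then have eq: "snd (?t i) = j" if "k \<le> i" for i
        using k snd_trades_mono[OF that, of a b N s] by (meson le_antisym le_trans)
      \<comment> \<open>The inequality \<open>l > k\<close> is strict so that the state in which the
        trade at \<open>l\<close> starts also has count \<open>j\<close>.\<close>
      from low obtain l where l: "l > k" "s l < a"
        by (auto simp: INFM_nat)
      have held: "fst (?t i)" if "l \<le> i" for i
        using that
      proof (induction i rule: dec_induct)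
        case base
        from l obtain l' where l': "l = Suc l'" "k \<le> l'" by (cases l) auto
        show ?case
          using eq[of l'] eq[of l] l Suc.prems l' by (cases "?t l'") auto
      next
        case (step i)
        then show ?case
          using eq[of i] eq[of "Suc i"] l by (cases "?t i") (auto split: if_splits)
      qed
      from high obtain h where h: "h > l" "b < s h"
        by (auto simp: INFM_nat)
      then obtain h' where h': "h = Suc h'" "l \<le> h'" by (cases h) auto
      show False
        using held[of h'] eq[of h'] eq[of h] h h' l by (cases "?t h'") auto
    qed
  qed auto
  then show ?thesis by blast
qed

section \<open>The upcrossing bound\<close>

context filtered_prob_space
begin

lemma measurable_trades:
  assumes S: "\<And>k. S k \<in> borel_measurable (F k)"
  shows "(\<lambda>\<omega>. trades a b N (\<lambda>k. S k \<omega>) k) \<in> measurable (F k) (count_space UNIV)"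
proof (induction k)
  case 0
  note S[of 0, measurable]
  show ?case by simp
next
  case (Suc k)
  note S[of "Suc k", measurable]
  have "(\<lambda>\<omega>. trade a b N st (S (Suc k) \<omega>)) \<in> measurable (F (Suc k)) (count_space UNIV)" for st
    by (cases st) simp
  then show ?case
    unfolding trades.simps
    by (rule measurable_compose_countable) (rule measurable_F_Suc[OF Suc])
qed

text \<open>The state after trading at \<open>k\<close> is known at time \<open>k\<close>, so its
  asset coefficient is an admissible test function: holding until \<open>Suc k\<close> does not
  raise the expected capital. The trade at \<open>Suc k\<close> does not raise it either, by
  \<open>capital_trade_le\<close>.\<close>

lemma nn_integral_capital_le_1:
  assumes S: "nn_supermartingale S" and a: "0 < a" "a < \<top>"
  shows "(\<integral>\<^sup>+\<omega>. capital a b (trades a b N (\<lambda>k. S k \<omega>) k) (S k \<omega>) \<partial>M) \<le> 1"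
proof (induction k)
  case 0
  have "(\<integral>\<^sup>+\<omega>. capital a b (trades a b N (\<lambda>k. S k \<omega>) 0) (S 0 \<omega>) \<partial>M) \<le> (\<integral>\<^sup>+\<omega>. 1 \<partial>M)"
    \<comment> \<open>The state before the first trade is all cash and is worth 1 at every
      price.\<close>
    using capital_trade_le[OF a, of b N "(False, 0)"]
    by (intro nn_integral_mono) (simp add: capital_def del: trade.simps)
  then show ?case by (simp add: emeasure_space_1)
next
  case (Suc k)
  define t where "t \<omega> = trades a b N (\<lambda>k. S k \<omega>) k" for \<omega>
  have S_meas: "\<And>k. S k \<in> borel_measurable (F k)"
    and S_int: "\<And>k f. f \<in> borel_measurable (F k) \<Longrightarrow>
      (\<integral>\<^sup>+\<omega>. f \<omega> * S (Suc k) \<omega> \<partial>M) \<le> (\<integral>\<^sup>+\<omega>. f \<omega> * S k \<omega> \<partial>M)"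
    using S by (auto simp: nn_supermartingale_def)
  have t: "t \<in> measurable (F k) (count_space UNIV)"
    unfolding t_def by (rule measurable_trades[OF S_meas])
  have coeff: "(\<lambda>\<omega>. c (t \<omega>)) \<in> borel_measurable (F k)" for c :: "bool \<times> nat \<Rightarrow> ennreal"
    using t by (rule measurable_compose) simp
  note [measurable] = measurable_F_M[OF coeff] measurable_F_M[OF S_meas]
  have "(\<integral>\<^sup>+\<omega>. capital a b (trades a b N (\<lambda>k. S k \<omega>) (Suc k)) (S (Suc k) \<omega>) \<partial>M)
      \<le> (\<integral>\<^sup>+\<omega>. capital a b (t \<omega>) (S (Suc k) \<omega>) \<partial>M)"
    unfolding trades.simps t_def by (intro nn_integral_mono capital_trade_le a)
  also have "\<dots> = (\<integral>\<^sup>+\<omega>. asset_coeff a b (t \<omega>) * S (Suc k) \<omega> \<partial>M) + (\<integral>\<^sup>+\<omega>. cash_coeff a b (t \<omega>) \<partial>M)"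
    unfolding capital_def by (rule nn_integral_add) measurable
  also have "\<dots> \<le> (\<integral>\<^sup>+\<omega>. asset_coeff a b (t \<omega>) * S k \<omega> \<partial>M) + (\<integral>\<^sup>+\<omega>. cash_coeff a b (t \<omega>) \<partial>M)"
    by (intro add_right_mono S_int coeff)
  also have "\<dots> = (\<integral>\<^sup>+\<omega>. capital a b (t \<omega>) (S k \<omega>) \<partial>M)"
    unfolding capital_def by (rule nn_integral_add[symmetric]) measurable
  also have "\<dots> \<le> 1"
    using Suc unfolding t_def .
  finally show ?case .
qed

text \<open>Markov's inequality: after \<open>N\<close> sales the capital is cash worth at least
  \<open>(b / a) ^ N\<close>, while its expectation is at most 1. The events \<open>C k\<close>
  increase with \<open>k\<close>, so the bound passes to their union.\<close>

lemma prob_trades_le: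
  assumes S: "nn_supermartingale S" and ab: "0 < a" "a < b"
  shows "(b / a) ^ N * prob {\<omega>\<in>space M. \<exists>k. N \<le> snd (trades (ennreal a) (ennreal b) N (\<lambda>k. S k \<omega>) k)} \<le> 1"
proof -
  define t where "t k \<omega> = trades (ennreal a) (ennreal b) N (\<lambda>k. S k \<omega>) k" for k \<omega>
  define C where "C k = {\<omega>\<in>space M. N \<le> snd (t k \<omega>)}" for k
  have S_meas: "\<And>k. S k \<in> borel_measurable (F k)"
    using S by (auto simp: nn_supermartingale_def)
  have [measurable]: "t k \<in> measurable M (count_space UNIV)" for k
    unfolding t_def by (rule measurable_F_M[OF measurable_trades[OF S_meas]])
  have [measurable]: "C k \<in> sets M" for k
    unfolding C_def by measurable
  have ratio: "ennreal b / ennreal a = ennreal (b / a)"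
    using ab by (simp add: divide_ennreal)
  have C_le: "(b / a) ^ N * prob (C k) \<le> 1" for k
  proof -
    have "ennreal ((b / a) ^ N * prob (C k)) = ennreal ((b / a) ^ N) * emeasure M (C k)"
      using ab by (simp add: emeasure_eq_measure ennreal_mult)
    also have "\<dots> = (\<integral>\<^sup>+\<omega>. ennreal ((b / a) ^ N) * indicator (C k) \<omega> \<partial>M)"
      by (simp add: nn_integral_cmult_indicator)
    also have "\<dots> \<le> (\<integral>\<^sup>+\<omega>. capital (ennreal a) (ennreal b) (t k \<omega>) (S k \<omega>) \<partial>M)"
    proof (intro nn_integral_mono)
      fix \<omega>
      have "ennreal ((b / a) ^ N) \<le> capital (ennreal a) (ennreal b) (t k \<omega>) (S k \<omega>)" if "\<omega> \<in> C k"
      proof -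
        have "\<not> fst (t k \<omega>)"
          using trades_held[of "ennreal a" "ennreal b" N "\<lambda>k. S k \<omega>" k] that
          by (auto simp: C_def t_def)
        moreover have "(b / a) ^ N \<le> (b / a) ^ snd (t k \<omega>)"
          using that ab by (intro power_increasing) (auto simp: C_def)
        ultimately show ?thesis
          using ab by (cases "t k \<omega>") (simp add: capital_def ratio ennreal_power ennreal_leI)
      qed
      then show "ennreal ((b / a) ^ N) * indicator (C k) \<omega>
          \<le> capital (ennreal a) (ennreal b) (t k \<omega>) (S k \<omega>)"
        by (simp add: indicator_def)
    qed
    also have "\<dots> \<le> 1"
      unfolding t_def using ab by (intro nn_integral_capital_le_1 S) auto
    finally show ?thesis by simp
  qed
  have "incseq C"
    by (intro incseq_SucI) (auto simp: C_def t_def intro: order_trans snd_trades_Suc simp del: trades.simps)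
  then have "(\<lambda>k. (b / a) ^ N * prob (C k)) \<longlonglongrightarrow> (b / a) ^ N * prob (\<Union>k. C k)"
    by (intro tendsto_intros finite_Lim_measure_incseq) auto
  then have "(b / a) ^ N * prob (\<Union>k. C k) \<le> 1"
    by (rule LIMSEQ_le_const2) (use C_le in auto)
  also have "(\<Union>k. C k) = {\<omega>\<in>space M. \<exists>k. N \<le> snd (t k \<omega>)}"
    by (auto simp: C_def)
  finally show ?thesis by (simp add: t_def)
qed

text \<open>On the bad event the gambler completes \<open>N\<close> sales for every
  \<open>N\<close>, so \<open>prob_trades_le\<close> bounds its probability for all \<open>N\<close>
  at once. The powers of \<open>b / a > 1\<close> are unbounded, which forces probability 0.\<close>

lemma AE_finitely_many_upcrossings:
  assumes S: "nn_supermartingale S" and ab: "0 < a" "a < b"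
  shows "AE \<omega> in M. \<not> ((\<exists>\<^sub>\<infinity>k. S k \<omega> < ennreal a) \<and> (\<exists>\<^sub>\<infinity>k. ennreal b < S k \<omega>))"
proof -
  define B where "B = {\<omega>\<in>space M. (\<exists>\<^sub>\<infinity>k. S k \<omega> < ennreal a) \<and> (\<exists>\<^sub>\<infinity>k. ennreal b < S k \<omega>)}"
  have S_meas: "\<And>k. S k \<in> borel_measurable (F k)"
    using S by (auto simp: nn_supermartingale_def)
  note [measurable] = measurable_F_M[OF S_meas] measurable_F_M[OF measurable_trades[OF S_meas]]
  have [measurable]: "B \<in> sets M"
    unfolding B_def INFM_nat by measurable
  have le: "(b / a) ^ N * prob B \<le> 1" for N
  proof -
    have "(b / a) ^ N * prob B \<le> (b / a) ^ N *
        prob {\<omega>\<in>space M. \<exists>k. N \<le> snd (trades (ennreal a) (ennreal b) N (\<lambda>k. S k \<omega>) k)}"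
      using ab by (intro mult_left_mono finite_measure_mono)
        (auto simp: B_def intro!: trades_complete)
    also have "\<dots> \<le> 1"
      by (rule prob_trades_le[OF S ab])
    finally show ?thesis .
  qed
  have "prob B = 0"
  proof (rule ccontr)
    assume "prob B \<noteq> 0"
    then have pos: "prob B > 0" by (simp add: zero_less_measure_iff)
    obtain N where "1 / prob B < (b / a) ^ N"
      using real_arch_pow[of "b / a" "1 / prob B"] ab by auto
    with le[of N] pos show False by (simp add: field_simps)
  qed
  then have "AE \<omega> in M. \<omega> \<notin> B"
    by (simp add: prob_eq_0)
  then show ?thesis
    by (rule AE_mp) (auto simp: B_def)
qed

end

text \<open>A gap between \<open>liminf s\<close> and \<open>limsup s\<close> would contain two
  rationals crossed infinitely often. Rational levels make the exceptional null sets of the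
  upcrossing lemma a countable family.\<close>

lemma ennreal_tendsto_if_no_oscillation:
  fixes s :: "nat \<Rightarrow> ennreal"
  assumes "\<And>p q :: rat. 0 < p \<Longrightarrow> p < q \<Longrightarrow>
    \<not> ((\<exists>\<^sub>\<infinity>k. s k < ennreal (of_rat p)) \<and> (\<exists>\<^sub>\<infinity>k. ennreal (of_rat q) < s k))"
  shows "s \<longlonglongrightarrow> liminf s"
proof -
  have "\<not> liminf s < limsup s"
  proof
    assume "liminf s < limsup s"
    then obtain q where q: "liminf s < ennreal (real_of_rat q)" "ennreal (real_of_rat q) < limsup s"
      using ennreal_rat_dense by auto
    obtain p where p: "liminf s < ennreal (real_of_rat p)" "ennreal (real_of_rat p) < ennreal (real_of_rat q)"
      using ennreal_rat_dense[OF q(1)] by auto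
    have "0 < ennreal (real_of_rat p)"
      using p(1) by (rule le_less_trans[rotated]) simp
    then have "0 < p" "p < q"
      using p(2) by (auto simp: ennreal_less_iff of_rat_less)
    moreover have "\<exists>\<^sub>\<infinity>k. s k < ennreal (of_rat p)"
    proof (rule ccontr)
      assume "\<not> ?thesis"
      then have "\<forall>\<^sub>F k in sequentially. ennreal (of_rat p) \<le> s k"
        by (simp add: not_frequently not_less cofinite_eq_sequentially)
      then have "ennreal (of_rat p) \<le> liminf s"
        by (rule Liminf_bounded)
      with p show False by simp
    qed
    moreover have "\<exists>\<^sub>\<infinity>k. ennreal (of_rat q) < s k"
    proof (rule ccontr)
      assume "\<not> ?thesis"
      then have "\<forall>\<^sub>F k in sequentially. s k \<le> ennreal (of_rat q)"
        by (simp add: not_frequently not_less cofinite_eq_sequentially)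
      then have "limsup s \<le> ennreal (of_rat q)"
        by (rule Limsup_bounded)
      with q show False by simp
    qed
    ultimately show False using assms by blast
  qed
  then have "liminf s = limsup s"
    using Liminf_le_Limsup[of sequentially s] by auto
  then show ?thesis
    using tendsto_iff_Liminf_eq_Limsup[of sequentially s] by simp
qed

section \<open>Almost sure convergence of nonnegative supermartingales\<close>

context filtered_prob_space
begin

theorem nn_supermartingale_AE_tendsto:
  assumes S: "nn_supermartingale S" and fin: "(\<integral>\<^sup>+\<omega>. S 0 \<omega> \<partial>M) < \<infinity>"
  shows "AE \<omega> in M. \<exists>l<\<infinity>. (\<lambda>k. S k \<omega>) \<longlonglongrightarrow> l"
proof -
  have S_meas: "\<And>k. S k \<in> borel_measurable (F k)"
    and S_int: "\<And>k f. f \<in> borel_measurable (F k) \<Longrightarrow>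
      (\<integral>\<^sup>+\<omega>. f \<omega> * S (Suc k) \<omega> \<partial>M) \<le> (\<integral>\<^sup>+\<omega>. f \<omega> * S k \<omega> \<partial>M)"
    using S by (auto simp: nn_supermartingale_def)
  note [measurable] = measurable_F_M[OF S_meas]
  have "(\<integral>\<^sup>+\<omega>. S k \<omega> \<partial>M) \<le> (\<integral>\<^sup>+\<omega>. S 0 \<omega> \<partial>M)" for k
  proof (induction k)
    case (Suc k)
    then show ?case
      using S_int[of "\<lambda>_. 1" k] by simp
  qed simp
  then have "liminf (\<lambda>k. \<integral>\<^sup>+\<omega>. S k \<omega> \<partial>M) \<le> (\<integral>\<^sup>+\<omega>. S 0 \<omega> \<partial>M)"
    by (intro order_trans[OF Liminf_le_Limsup] Limsup_bounded) auto
  \<comment> \<open>Fatou's lemma; it makes the limit finite almost surely.\<close>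
  then have "(\<integral>\<^sup>+\<omega>. liminf (\<lambda>k. S k \<omega>) \<partial>M) < \<infinity>"
    using nn_integral_liminf[of S M] fin by (meson measurable_F_M[OF S_meas] le_less_trans order_trans)
  then have "AE \<omega> in M. liminf (\<lambda>k. S k \<omega>) \<noteq> \<infinity>"
    by (intro nn_integral_noteq_infinite) auto
  moreover have "AE \<omega> in M. \<forall>p q :: rat. 0 < p \<longrightarrow> p < q \<longrightarrow>
      \<not> ((\<exists>\<^sub>\<infinity>k. S k \<omega> < ennreal (of_rat p)) \<and> (\<exists>\<^sub>\<infinity>k. ennreal (of_rat q) < S k \<omega>))"
    unfolding AE_all_countable
    by (intro allI AE_impI AE_finitely_many_upcrossings[OF S]) (auto simp: of_rat_less)
  ultimately show ?thesis
  proof eventually_elim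
    case (elim \<omega>)
    then show ?case
      using ennreal_tendsto_if_no_oscillation[of "\<lambda>k. S k \<omega>"]
      by (intro exI[of _ "liminf (\<lambda>k. S k \<omega>)"]) (auto simp: less_top)
  qed
qed

end

subsection \<open>The Robbins-Siegmund theorem\<close>

lemma convergent_prod_one_plus:
  fixes \<alpha> :: "nat \<Rightarrow> real"
  assumes "\<And>k. 0 \<le> \<alpha> k" "summable \<alpha>"
  shows "convergent (\<lambda>k. \<Prod>j<k. 1 + \<alpha> j)"
proof (rule Bseq_mono_convergent)
  have "(\<Prod>j<k. 1 + \<alpha> j) \<le> exp (suminf \<alpha>)" for k
  proof -
    have "(\<Prod>j<k. 1 + \<alpha> j) \<le> (\<Prod>j<k. exp (\<alpha> j))"
      using assms by (intro prod_mono) (auto intro: add_nonneg_nonneg)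
    also have "\<dots> = exp (\<Sum>j<k. \<alpha> j)"
      by (simp add: exp_sum)
    also have "\<dots> \<le> exp (suminf \<alpha>)"
      using assms by (simp add: sum_le_suminf)
    finally show ?thesis .
  qed
  moreover have "0 \<le> (\<Prod>j<k. 1 + \<alpha> j)" for k
    using assms by (intro prod_nonneg) (auto intro: add_nonneg_nonneg)
  ultimately show "Bseq (\<lambda>k. \<Prod>j<k. 1 + \<alpha> j)"
    by (intro BseqI'[of _ "exp (suminf \<alpha>)"]) auto
  show "\<forall>m n. m \<le> n \<longrightarrow> (\<Prod>j<m. 1 + \<alpha> j) \<le> (\<Prod>j<n. 1 + \<alpha> j)"
    using assms by (auto intro!: prod_mono2)
qed

text \<open>Since \<open>y k / P k\<close> is nonnegative, the discounted losses have bounded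
  partial sums and form a convergent series, which leaves convergence of \<open>y k / P k\<close>.
  As \<open>P\<close> is positive, bounded and convergent, multiplying it back gives both
  claims.\<close>

lemma convergent_rescale:
  fixes y \<alpha> z :: "nat \<Rightarrow> real"
  defines "P \<equiv> \<lambda>k. \<Prod>j<k. 1 + \<alpha> j"
  assumes nonneg: "\<And>k. 0 \<le> y k" "\<And>k. 0 \<le> \<alpha> k" "\<And>k. 0 \<le> z k"
    and \<alpha>: "summable \<alpha>"
    and conv: "convergent (\<lambda>k. y k / P k + (\<Sum>j<k. z j / P (Suc j)))"
  shows "convergent y \<and> summable z"
proof -
  have P: "1 \<le> P k" for k
    unfolding P_def using nonneg by (intro prod_ge_1) auto
  have P0: "0 < P k" for k
    using P[of k] by simp
  have convP: "convergent P"
    unfolding P_def by (rule convergent_prod_one_plus) (use nonneg \<alpha> in auto)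
  obtain C where C: "\<And>k. P k \<le> C"
    using convergent_imp_Bseq[OF convP] by (auto simp: Bseq_def abs_le_iff)
  obtain K where K: "\<And>k. y k / P k + (\<Sum>j<k. z j / P (Suc j)) \<le> K"
    using convergent_imp_Bseq[OF conv] by (auto simp: Bseq_def abs_le_iff)
  have z': "summable (\<lambda>j. z j / P (Suc j))"
  proof (rule summableI_nonneg_bounded)
    show "(\<Sum>j<k. z j / P (Suc j)) \<le> K" for k
    proof -
      have "0 \<le> y k / P k"
        using nonneg P0[of k] by simp
      then show ?thesis using K[of k] by linarith
    qed
  qed (use nonneg P0 in \<open>auto intro: divide_nonneg_pos\<close>)
  have "summable z"
  proof (rule summable_comparison_test')
    show "summable (\<lambda>j. C * (z j / P (Suc j)))"
      using z' by (rule summable_mult)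
    show "norm (z j) \<le> C * (z j / P (Suc j))" for j
      using nonneg(3)[of j] C[of "Suc j"] P0[of "Suc j"]
      by (simp add: pos_le_divide_eq mult.commute[of C] mult_left_mono)
  qed
  moreover have "convergent (\<lambda>k. \<Sum>j<k. z j / P (Suc j))"
    using z' by (simp add: summable_iff_convergent)
  then have "convergent (\<lambda>k. y k / P k)"
    using convergent_diff[OF conv] by fastforce
  then have "convergent (\<lambda>k. y k / P k * P k)"
    using convP by (rule convergent_mult)
  then have "convergent y"
    using P0 by (simp add: less_imp_neq[symmetric])
  ultimately show ?thesis by blast
qed

text \<open>The assumption \<open>step\<close> is the Robbins-Siegmund inequality in tested form.
  The term \<open>z k\<close> stands on the left, so both integrands are nonnegative and no
  truncated subtraction in \<open>ennreal\<close> occurs.\<close>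

locale almost_supermartingale = filtered_prob_space M F
  for M :: "'w measure" and F :: "nat \<Rightarrow> 'w measure" +
  fixes y \<alpha> \<beta> z :: "nat \<Rightarrow> 'w \<Rightarrow> real"
  assumes y_meas: "\<And>k. y k \<in> borel_measurable (F k)"
    and \<alpha>_meas: "\<And>k. \<alpha> k \<in> borel_measurable (F k)"
    and \<beta>_meas: "\<And>k. \<beta> k \<in> borel_measurable (F k)"
    and z_meas: "\<And>k. z k \<in> borel_measurable (F k)"
    and nonneg [simp]: "\<And>k \<omega>. 0 \<le> y k \<omega>" "\<And>k \<omega>. 0 \<le> \<alpha> k \<omega>" "\<And>k \<omega>. 0 \<le> \<beta> k \<omega>" "\<And>k \<omega>. 0 \<le> z k \<omega>"
    and step: "\<And>k f. f \<in> borel_measurable (F k) \<Longrightarrow>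
      (\<integral>\<^sup>+\<omega>. f \<omega> * ennreal (y (Suc k) \<omega> + z k \<omega>) \<partial>M)
        \<le> (\<integral>\<^sup>+\<omega>. f \<omega> * ennreal ((1 + \<alpha> k \<omega>) * y k \<omega> + \<beta> k \<omega>) \<partial>M)"
begin

section \<open>Discounting and killing\<close>

definition growth :: "nat \<Rightarrow> 'w \<Rightarrow> real" where
  "growth k \<omega> = (\<Prod>j<k. 1 + \<alpha> j \<omega>)"

definition gain :: "nat \<Rightarrow> 'w \<Rightarrow> real" where
  "gain k \<omega> = (\<Sum>j<k. \<beta> j \<omega> / growth (Suc j) \<omega>)"

definition loss :: "nat \<Rightarrow> 'w \<Rightarrow> real" where
  "loss k \<omega> = (\<Sum>j<k. z j \<omega> / growth (Suc j) \<omega>)"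

text \<open>No integrability of \<open>y 0\<close> is assumed; restricting to
  \<open>y 0 \<le> n\<close>, an event known at time 0, gives the killed process a finite initial
  expectation.\<close>

definition alive :: "nat \<Rightarrow> nat \<Rightarrow> 'w \<Rightarrow> bool" where
  "alive n k \<omega> \<longleftrightarrow> y 0 \<omega> \<le> n \<and> gain k \<omega> \<le> n"

text \<open>Killing the process once \<open>gain\<close> exceeds \<open>n\<close> keeps it nonnegative; since \<open>gain (Suc k)\<close> is
  known at time \<open>k\<close>, the supermartingale inequality survives.\<close>

definition killed :: "nat \<Rightarrow> nat \<Rightarrow> 'w \<Rightarrow> ennreal" where
  "killed n k \<omega> = (if alive n k \<omega>
     then ennreal (y k \<omega> / growth k \<omega> + loss k \<omega> + (n - gain k \<omega>)) else 0)"

lemma growth_ge_1: "1 \<le> growth k \<omega>"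
  unfolding growth_def by (intro prod_ge_1) auto

lemma growth_pos [simp]: "0 < growth k \<omega>"
  using growth_ge_1[of k \<omega>] by simp

lemma growth_Suc: "growth (Suc k) \<omega> = growth k \<omega> * (1 + \<alpha> k \<omega>)"
  by (simp add: growth_def)

lemma loss_nonneg [simp]: "0 \<le> loss k \<omega>"
  unfolding loss_def by (intro sum_nonneg divide_nonneg_pos) auto

lemma gain_Suc_ge: "gain k \<omega> \<le> gain (Suc k) \<omega>"
  by (simp add: gain_def divide_nonneg_pos)

text \<open>The product up to \<open>j\<close> involves only indices below \<open>j\<close>, so it
  is known one step early. The same holds for \<open>gain\<close>, \<open>loss\<close> and
  \<open>alive\<close>.\<close>

lemma growth_meas: "j \<le> Suc k \<Longrightarrow> growth j \<in> borel_measurable (F k)"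
  unfolding growth_def
  by (intro borel_measurable_prod borel_measurable_add borel_measurable_const)
    (auto intro!: measurable_F_mono[OF \<alpha>_meas])

lemma gain_meas: "j \<le> Suc k \<Longrightarrow> gain j \<in> borel_measurable (F k)"
  unfolding gain_def
  by (intro borel_measurable_sum borel_measurable_divide)
    (auto intro!: measurable_F_mono[OF \<beta>_meas] growth_meas)

lemma loss_meas: "j \<le> Suc k \<Longrightarrow> loss j \<in> borel_measurable (F k)"
  unfolding loss_def
  by (intro borel_measurable_sum borel_measurable_divide)
    (auto intro!: measurable_F_mono[OF z_meas] growth_meas)

lemma alive_meas: "j \<le> Suc k \<Longrightarrow> Measurable.pred (F k) (alive n j)"
proof -
  assume j: "j \<le> Suc k"
  note [measurable] = gain_meas[OF j] measurable_F_mono[OF y_meas[of 0], of k]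
  show ?thesis unfolding alive_def by measurable
qed

text \<open>At time \<open>Suc k\<close> the killed process is affine in
  \<open>y (Suc k) + z k\<close>, with coefficients known at time \<open>k\<close>. Hence
  \<open>step\<close> applies with the discount and the survival indicator absorbed into the test
  function \<open>g\<close>.\<close>

lemma nn_supermartingale_killed: "nn_supermartingale (killed n)"
  unfolding nn_supermartingale_def
proof (intro conjI allI ballI)
  fix k
  note [measurable] = y_meas[of k] growth_meas[of k k] loss_meas[of k k] gain_meas[of k k] alive_meas[of k k n]
  show "killed n k \<in> borel_measurable (F k)"
    unfolding killed_def by measurable
next
  fix k and f :: "'w \<Rightarrow> ennreal" assume f: "f \<in> borel_measurable (F k)"
  define g where "g \<omega> = f \<omega> * (if alive n (Suc k) \<omega> then ennreal (1 / growth (Suc k) \<omega>) else 0)" for \<omega>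
  define h where "h \<omega> = f \<omega> *
    (if alive n (Suc k) \<omega> then ennreal (loss k \<omega> + (n - gain (Suc k) \<omega>)) else 0)" for \<omega>
  note [measurable] = f growth_meas[of "Suc k" k, simplified] gain_meas[of "Suc k" k, simplified]
    loss_meas[of k k, simplified] alive_meas[of "Suc k" k n, simplified]
  have g: "g \<in> borel_measurable (F k)" and h: "h \<in> borel_measurable (F k)"
    unfolding g_def h_def by measurable
  note [measurable] = measurable_F_M[OF g] measurable_F_M[OF h] measurable_F_M[OF y_meas]
    measurable_F_M[OF \<alpha>_meas] measurable_F_M[OF \<beta>_meas] measurable_F_M[OF z_meas]
  have affine: "ennreal (c * x + d) = ennreal c * ennreal x + ennreal d" if "0 \<le> c" "0 \<le> x" "0 \<le> d" for c x d
    using that by (simp add: ennreal_mult)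
  \<comment> \<open>The last summand of \<open>loss (Suc k)\<close> carries the same discount as
    \<open>y (Suc k)\<close>, so the two merge. Survival makes the remainder in \<open>h\<close>
    nonnegative.\<close>
  have split: "f \<omega> * killed n (Suc k) \<omega> = g \<omega> * ennreal (y (Suc k) \<omega> + z k \<omega>) + h \<omega>" for \<omega>
  proof (cases "alive n (Suc k) \<omega>")
    case True
    have "killed n (Suc k) \<omega> = ennreal (1 / growth (Suc k) \<omega> * (y (Suc k) \<omega> + z k \<omega>)
        + (loss k \<omega> + (n - gain (Suc k) \<omega>)))"
      using True by (simp add: killed_def loss_def add_divide_distrib algebra_simps)
    also have "\<dots> = ennreal (1 / growth (Suc k) \<omega>) * ennreal (y (Suc k) \<omega> + z k \<omega>)
        + ennreal (loss k \<omega> + (n - gain (Suc k) \<omega>))"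
      using True by (intro affine) (auto simp: alive_def less_imp_le)
    finally show ?thesis
      using True by (simp add: g_def h_def distrib_left mult.assoc)
  qed (simp add: killed_def g_def h_def)
  \<comment> \<open>On surviving paths this is an equality: the discount cancels
    \<open>1 + \<alpha> k\<close>, and the discounted \<open>\<beta> k\<close> turns
    \<open>n - gain (Suc k)\<close> into \<open>n - gain k\<close>. On the other paths the left side
    is 0.\<close>
  have bound: "g \<omega> * ennreal ((1 + \<alpha> k \<omega>) * y k \<omega> + \<beta> k \<omega>) + h \<omega> \<le> f \<omega> * killed n k \<omega>" for \<omega>
  proof (cases "alive n (Suc k) \<omega>")
    case True
    then have alive: "alive n k \<omega>"
      using gain_Suc_ge[of k \<omega>] by (simp add: alive_def)
    have "1 / growth (Suc k) \<omega> * ((1 + \<alpha> k \<omega>) * y k \<omega>) = y k \<omega> / growth k \<omega>"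
      using nonneg(2)[of k \<omega>] by (simp add: growth_Suc add_nonneg_eq_0_iff)
    then have "y k \<omega> / growth k \<omega> + loss k \<omega> + (n - gain k \<omega>)
        = 1 / growth (Suc k) \<omega> * ((1 + \<alpha> k \<omega>) * y k \<omega> + \<beta> k \<omega>)
          + (loss k \<omega> + (n - gain (Suc k) \<omega>))"
      by (simp add: gain_def distrib_left)
    with alive have "killed n k \<omega> = ennreal (1 / growth (Suc k) \<omega> * ((1 + \<alpha> k \<omega>) * y k \<omega> + \<beta> k \<omega>)
          + (loss k \<omega> + (n - gain (Suc k) \<omega>)))"
      by (simp only: killed_def if_True)
    also have "\<dots> = ennreal (1 / growth (Suc k) \<omega>) * ennreal ((1 + \<alpha> k \<omega>) * y k \<omega> + \<beta> k \<omega>)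
        + ennreal (loss k \<omega> + (n - gain (Suc k) \<omega>))"
      using True by (intro affine) (auto simp: alive_def less_imp_le)
    finally show ?thesis
      using True by (simp add: g_def h_def distrib_left mult.assoc)
  qed (simp add: g_def h_def)
  have "(\<integral>\<^sup>+\<omega>. f \<omega> * killed n (Suc k) \<omega> \<partial>M)
      = (\<integral>\<^sup>+\<omega>. g \<omega> * ennreal (y (Suc k) \<omega> + z k \<omega>) \<partial>M) + (\<integral>\<^sup>+\<omega>. h \<omega> \<partial>M)"
    unfolding split by (rule nn_integral_add) measurable
  also have "\<dots> \<le> (\<integral>\<^sup>+\<omega>. g \<omega> * ennreal ((1 + \<alpha> k \<omega>) * y k \<omega> + \<beta> k \<omega>) \<partial>M) + (\<integral>\<^sup>+\<omega>. h \<omega> \<partial>M)"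
    by (intro add_right_mono step g)
  also have "\<dots> = (\<integral>\<^sup>+\<omega>. g \<omega> * ennreal ((1 + \<alpha> k \<omega>) * y k \<omega> + \<beta> k \<omega>) + h \<omega> \<partial>M)"
    by (rule nn_integral_add[symmetric]) measurable
  also have "\<dots> \<le> (\<integral>\<^sup>+\<omega>. f \<omega> * killed n k \<omega> \<partial>M)"
    by (intro nn_integral_mono bound)
  finally show "(\<integral>\<^sup>+\<omega>. f \<omega> * killed n (Suc k) \<omega> \<partial>M) \<le> (\<integral>\<^sup>+\<omega>. f \<omega> * killed n k \<omega> \<partial>M)" .
qed

theorem robbins_siegmund:
  assumes "AE \<omega> in M. summable (\<lambda>k. \<alpha> k \<omega>)" and "AE \<omega> in M. summable (\<lambda>k. \<beta> k \<omega>)"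
  shows "AE \<omega> in M. convergent (\<lambda>k. y k \<omega>) \<and> summable (\<lambda>k. z k \<omega>)"
proof -
  have "AE \<omega> in M. \<exists>l<\<infinity>. (\<lambda>k. killed n k \<omega>) \<longlonglongrightarrow> l" for n
  proof (intro nn_supermartingale_AE_tendsto nn_supermartingale_killed)
    \<comment> \<open>At time 0 a surviving path has \<open>y 0 \<le> n\<close>, growth 1, no loss
      and no gain, so its value is at most \<open>n + n\<close>.\<close>
    have "(\<integral>\<^sup>+\<omega>. killed n 0 \<omega> \<partial>M) \<le> (\<integral>\<^sup>+\<omega>. ennreal (2 * real n) \<partial>M)"
      by (intro nn_integral_mono)
        (auto simp: killed_def alive_def growth_def loss_def gain_def
          simp flip: ennreal_plus intro!: ennreal_leI)
    also have "\<dots> < \<infinity>"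
      by (simp add: emeasure_space_1)
    finally show "(\<integral>\<^sup>+\<omega>. killed n 0 \<omega> \<partial>M) < \<infinity>" .
  qed
  then have "AE \<omega> in M. \<forall>n. \<exists>l<\<infinity>. (\<lambda>k. killed n k \<omega>) \<longlonglongrightarrow> l"
    by (simp add: AE_all_countable)
  with assms show ?thesis
  proof eventually_elim
    case (elim \<omega>)
    have gain_summable: "summable (\<lambda>j. \<beta> j \<omega> / growth (Suc j) \<omega>)"
    proof (rule summable_comparison_test'[OF elim(2)])
      show "norm (\<beta> j \<omega> / growth (Suc j) \<omega>) \<le> \<beta> j \<omega>" for j
        using growth_ge_1[of "Suc j" \<omega>] by (simp add: field_simps mult_left_mono)
          (metis mult.right_neutral mult_left_mono nonneg(3))
    qed
    \<comment> \<open>This level exceeds both \<open>y 0\<close> and the total discounted gain, so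
      this path is never killed.\<close>
    define n where "n = nat \<lceil>max (y 0 \<omega>) (\<Sum>j. \<beta> j \<omega> / growth (Suc j) \<omega>)\<rceil>"
    have "gain k \<omega> \<le> (\<Sum>j. \<beta> j \<omega> / growth (Suc j) \<omega>)" for k
      unfolding gain_def using gain_summable by (intro sum_le_suminf) (auto simp: divide_nonneg_pos)
    moreover have "max (y 0 \<omega>) (\<Sum>j. \<beta> j \<omega> / growth (Suc j) \<omega>) \<le> n"
      unfolding n_def by linarith
    ultimately have alive: "alive n k \<omega>" for k
      by (auto simp: alive_def intro: order_trans)
    define x where "x k = y k \<omega> / growth k \<omega> + loss k \<omega> + (n - gain k \<omega>)" for k
    have x_nonneg: "0 \<le> x k" for k
      unfolding x_def using alive[of k] by (auto simp: alive_def intro!: add_nonneg_nonneg divide_nonneg_pos)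
    obtain l where l: "l < \<infinity>" "(\<lambda>k. killed n k \<omega>) \<longlonglongrightarrow> l"
      using elim by blast
    then obtain r where r: "0 \<le> r" "l = ennreal r"
      by (cases l) auto
    have "x \<longlonglongrightarrow> r"
      using l(2) r x_nonneg alive by (simp add: killed_def flip: x_def)
    moreover have "convergent (\<lambda>k. gain k \<omega>)"
      using gain_summable by (simp add: gain_def summable_iff_convergent)
    ultimately have "convergent (\<lambda>k. x k + (gain k \<omega> - n))"
      by (intro convergent_add convergent_diff convergent_const) (auto simp: convergent_def)
    then have "convergent (\<lambda>k. y k \<omega> / growth k \<omega> + loss k \<omega>)"
      by (simp add: x_def)
    then show ?case
      using convergent_rescale[of "\<lambda>k. y k \<omega>" "\<lambda>k. \<alpha> k \<omega>" "\<lambda>k. z k \<omega>"] elim(1)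
      by (simp add: growth_def loss_def)
  qed
qed

end

subsection \<open>Vector sequences\<close>

lemma space_natural_filtration [simp]: "space (natural_filtration M X k) = space M"
  unfolding natural_filtration_def by (rule space_measure_of) auto

lemma sets_natural_filtration:
  "sets (natural_filtration M X k) =
     sigma_sets (space M) (\<Union>l\<le>k. {X l -` A \<inter> space M | A. A \<in> sets borel})"
  unfolding natural_filtration_def by (rule sets_measure_of) auto

lemma measurable_natural_filtration: "X k \<in> borel_measurable (natural_filtration M X k)"
  by (intro measurableI) (auto simp: sets_natural_filtration)

lemma subalgebra_natural_filtration:
  assumes "\<And>k. X k \<in> borel_measurable M"
  shows "subalgebra M (natural_filtration M X k)"
  unfolding subalgebra_def sets_natural_filtration
  using assms by (auto intro!: sets.sigma_sets_subset measurable_sets)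

lemma natural_filtration_Suc:
  "sets (natural_filtration M X k) \<subseteq> sets (natural_filtration M X (Suc k))"
  unfolding sets_natural_filtration by (intro sigma_sets_mono' UN_mono) auto

text \<open>The \<open>V\<close> term is controlled by \<open>\<pi> v* V \<le> \<pi>\<close>. The
  rank-one term contributes \<open>a * s\<close> times the entry sum of \<open>v\<close>, and that
  sum is at most \<open>(\<pi> \<bullet> v) / m\<close> because every weight is at least
  \<open>m\<close>.\<close>

lemma inner_step_le:
  fixes \<pi> v :: "real ^ 'd" and V :: "real ^ 'd ^ 'd"
  assumes m: "0 < m" "\<And>i. m \<le> \<pi> $ i" and v: "0 \<le> v" and a: "0 \<le> a"
    and V: "\<pi> v* V \<le> \<pi>"
  defines "s \<equiv> \<Sum>i\<in>UNIV. \<pi> $ i"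
  shows "\<pi> \<bullet> ((V + a *\<^sub>R (\<chi> i j. 1)) *v v + b *\<^sub>R (\<chi> i. 1) - h)
    \<le> (1 + s / m * a) * (\<pi> \<bullet> v) + s * b - \<pi> \<bullet> h"
proof -
  have v_nonneg: "0 \<le> v $ i" for i
    using v by (simp add: less_eq_vec_def)
  have \<pi>_pos: "0 < \<pi> $ i" for i
    using m(1) m(2)[of i] by simp
  have "\<pi> \<bullet> (V *v v) = (\<pi> v* V) \<bullet> v"
    by (simp add: dot_lmul_matrix)
  also have "\<dots> \<le> \<pi> \<bullet> v"
    unfolding inner_vec_def using V v_nonneg
    by (intro sum_mono) (auto simp: less_eq_vec_def intro: mult_right_mono)
  finally have 1: "\<pi> \<bullet> (V *v v) \<le> \<pi> \<bullet> v" .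
  have "m * (\<Sum>i\<in>UNIV. v $ i) \<le> \<pi> \<bullet> v"
    unfolding inner_vec_def sum_distrib_left using m v_nonneg
    by (intro sum_mono) (auto intro: mult_right_mono)
  then have "(\<Sum>i\<in>UNIV. v $ i) \<le> (\<pi> \<bullet> v) / m"
    using m(1) by (simp add: field_simps)
  moreover have "0 \<le> a * s"
    unfolding s_def using a \<pi>_pos by (intro mult_nonneg_nonneg sum_nonneg) (auto intro: less_imp_le)
  ultimately have "a * s * (\<Sum>i\<in>UNIV. v $ i) \<le> a * s * ((\<pi> \<bullet> v) / m)"
    by (rule mult_left_mono)
  moreover have "\<pi> \<bullet> ((a *\<^sub>R (\<chi> i j. 1)) *v v) = a * s * (\<Sum>i\<in>UNIV. v $ i)"
    by (simp add: inner_vec_def matrix_vector_mult_def s_def sum_distrib_left[symmetric]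
        sum_distrib_right[symmetric] algebra_simps)
  moreover have "\<pi> \<bullet> (\<chi> i. 1) = s"
    by (simp add: inner_vec_def s_def)
  ultimately show ?thesis
    using 1 by (simp add: matrix_vector_mult_add_rdistrib inner_add_right inner_diff_right algebra_simps)
qed

lemma ennreal_inner:
  fixes x y :: "real ^ 'd"
  assumes "\<And>i. 0 \<le> x $ i" "\<And>i. 0 \<le> y $ i"
  shows "ennreal (x \<bullet> y) = (\<Sum>i\<in>UNIV. ennreal (x $ i) * ennreal (y $ i))"
  using assms by (simp add: inner_vec_def sum_ennreal flip: ennreal_mult)

text \<open>All summands of \<open>\<pi> \<bullet> v k\<close> are nonnegative, so each entry of
  \<open>v k\<close> is at most \<open>K\<close> divided by its weight.\<close>

lemma bounded_if_inner_le:
  fixes \<pi> :: "real ^ 'd" and v :: "nat \<Rightarrow> real ^ 'd"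
  assumes \<pi>: "\<And>i. 0 < \<pi> $ i" and v: "\<And>k. 0 \<le> v k" and le: "\<And>k. \<pi> \<bullet> v k \<le> K"
  shows "bounded (range v)"
proof -
  have "norm (v k) \<le> (\<Sum>i\<in>UNIV. K / \<pi> $ i)" for k
  proof -
    have nonneg: "0 \<le> v k $ i" for i
      using v[of k] by (simp add: less_eq_vec_def)
    have "\<bar>v k $ i\<bar> \<le> K / \<pi> $ i" for i
    proof -
      have "\<pi> $ i * v k $ i \<le> \<pi> \<bullet> v k"
        unfolding inner_vec_def inner_real_def
        by (rule member_le_sum) (use \<pi> nonneg in \<open>auto intro: mult_nonneg_nonneg less_imp_le\<close>)
      then show ?thesis
        using le[of k] \<pi>[of i] nonneg[of i] by (simp add: pos_le_divide_eq mult.commute)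
    qed
    then show ?thesis
      by (intro order_trans[OF norm_le_l1_cart] sum_mono)
  qed
  then show ?thesis
    by (auto simp: bounded_iff)
qed

theorem lemma5:
  fixes M :: "'w measure"
    and v :: "nat \<Rightarrow> 'w \<Rightarrow> real ^ 'd"
    and u :: "nat \<Rightarrow> 'w \<Rightarrow> real ^ 'p"
    and a b :: "nat \<Rightarrow> 'w \<Rightarrow> real"
    and V :: "nat \<Rightarrow> 'w \<Rightarrow> real ^ 'd ^ 'd"
    and H :: "nat \<Rightarrow> 'w \<Rightarrow> real ^ 'p ^ 'd"
    and \<pi> :: "real ^ 'd"
  defines "F \<equiv> natural_filtration M (\<lambda>k \<omega>. (v k \<omega>, u k \<omega>, a k \<omega>, b k \<omega>, V k \<omega>, H k \<omega>))"
  assumes "prob_space M"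
    and "\<And>k. v k \<in> borel_measurable M"
    and "\<And>k. u k \<in> borel_measurable M"
    and "\<And>k. a k \<in> borel_measurable M"
    and "\<And>k. b k \<in> borel_measurable M"
    and "\<And>k. V k \<in> borel_measurable M"
    and "\<And>k. H k \<in> borel_measurable M"
    and "AE \<omega> in M. \<forall>k. 0 \<le> v k \<omega> \<and> 0 \<le> u k \<omega> \<and> 0 \<le> a k \<omega> \<and> 0 \<le> b k \<omega>
                        \<and> 0 \<le> V k \<omega> \<and> 0 \<le> H k \<omega>"
    and "AE \<omega> in M. \<forall>k i. nonneg_cond_exp_vec M (F k) (v (Suc k)) \<omega> $ i
           \<le> ereal (((V k \<omega> + a k \<omega> *\<^sub>R (\<chi> i j. 1)) *v v k \<omega>
                       + b k \<omega> *\<^sub>R (\<chi> i. 1) - H k \<omega> *v u k \<omega>) $ i)"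
    and "AE \<omega> in M. summable (\<lambda>k. a k \<omega>)"
    and "AE \<omega> in M. summable (\<lambda>k. b k \<omega>)"
    and "\<And>i. 0 < \<pi> $ i"
    and "AE \<omega> in M. \<forall>k. \<pi> v* V k \<omega> \<le> \<pi> \<and> 0 \<le> \<pi> v* H k \<omega>"
  shows "(\<exists>v_lim \<in> borel_measurable M. AE \<omega> in M.
            0 \<le> \<pi> \<bullet> v_lim \<omega> \<and> (\<lambda>k. \<pi> \<bullet> v k \<omega>) \<longlonglongrightarrow> \<pi> \<bullet> v_lim \<omega>)
       \<and> (AE \<omega> in M. bounded (range (\<lambda>k. v k \<omega>)))
       \<and> (AE \<omega> in M. summable (\<lambda>k. \<pi> \<bullet> (H k \<omega> *v u k \<omega>)))"
proof -
  note meas [measurable] = assms(3-8) and data_nonneg = assms(9) and cond = assms(10)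
    and sum_a = assms(11) and sum_b = assms(12) and \<pi>_pos = assms(13) and \<pi>_le = assms(14)
  define X where "X k \<omega> = (v k \<omega>, u k \<omega>, a k \<omega>, b k \<omega>, V k \<omega>, H k \<omega>)" for k \<omega>
  have F: "F = natural_filtration M X"
    unfolding F_def X_def ..
  have X: "X k \<in> borel_measurable M" for k
    unfolding X_def by (intro borel_measurable_Pair meas)
  interpret prob_space M by fact
  interpret filtered_prob_space M F
    by unfold_locales (auto simp: F intro: subalgebra_natural_filtration X subsetD[OF natural_filtration_Suc])
  interpret cond: finite_measure_subalgebra M "F k" for k
    by unfold_locales (rule subalg)

  define s where "s = (\<Sum>i\<in>UNIV. \<pi> $ i)"
  define m where "m = Min (range (($) \<pi>))"
  have m: "0 < m" "\<And>i. m \<le> \<pi> $ i"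
    unfolding m_def using \<pi>_pos by (auto simp: Min_gr_iff)
  have s: "0 \<le> s"
    unfolding s_def using \<pi>_pos by (intro sum_nonneg) (auto intro: less_imp_le)
  \<comment> \<open>Truncation at 0 gives nonnegativity at every point, as the locale demands, where
    the data are nonnegative only almost surely; \<open>AE_eq\<close> shows that almost surely
    nothing changes.\<close>
  define y where "y k \<omega> = max 0 (\<pi> \<bullet> v k \<omega>)" for k \<omega>
  define \<alpha> where "\<alpha> k \<omega> = s / m * max 0 (a k \<omega>)" for k \<omega>
  define \<beta> where "\<beta> k \<omega> = s * max 0 (b k \<omega>)" for k \<omega>
  define z where "z k \<omega> = max 0 (\<pi> \<bullet> (H k \<omega> *v u k \<omega>))" for k \<omega>

  have F_meas: "(\<lambda>\<omega>. \<phi> (X k \<omega>)) \<in> borel_measurable (F k)" if "continuous_on UNIV \<phi>"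
    for k and \<phi> :: "_ \<Rightarrow> real"
    unfolding F by (rule measurable_compose[OF measurable_natural_filtration borel_measurable_continuous_onI[OF that]])
  have y_meas: "y k \<in> borel_measurable (F k)" for k
  proof -
    have "(\<lambda>\<omega>. (\<lambda>(v, u, a, b, V, H). max 0 (\<pi> \<bullet> v)) (X k \<omega>)) \<in> borel_measurable (F k)"
      unfolding split_beta by (intro F_meas continuous_intros)
    then show ?thesis by (simp add: X_def y_def[abs_def])
  qed
  have \<alpha>_meas: "\<alpha> k \<in> borel_measurable (F k)" for k
  proof -
    have "(\<lambda>\<omega>. (\<lambda>(v, u, a, b, V, H). s / m * max 0 a) (X k \<omega>)) \<in> borel_measurable (F k)"
      unfolding split_beta by (intro F_meas continuous_intros)
    then show ?thesis by (simp add: X_def \<alpha>_def[abs_def])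
  qed
  have \<beta>_meas: "\<beta> k \<in> borel_measurable (F k)" for k
  proof -
    have "(\<lambda>\<omega>. (\<lambda>(v, u, a, b, V, H). s * max 0 b) (X k \<omega>)) \<in> borel_measurable (F k)"
      unfolding split_beta by (intro F_meas continuous_intros)
    then show ?thesis by (simp add: X_def \<beta>_def[abs_def])
  qed
  have z_meas: "z k \<in> borel_measurable (F k)" for k
  proof -
    \<comment> \<open>Written entrywise, the loss is a polynomial in the coordinates, to which the
      continuity rules apply.\<close>
    have "(\<lambda>\<omega>. (\<lambda>(v, u, a, b, V, H). max 0 (\<Sum>i\<in>UNIV. \<pi> $ i * (\<Sum>j\<in>UNIV. H $ i $ j * u $ j))) (X k \<omega>))
        \<in> borel_measurable (F k)"
      unfolding split_beta by (intro F_meas continuous_intros)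
    then show ?thesis by (simp add: X_def z_def[abs_def] inner_vec_def matrix_vector_mult_def)
  qed

  have inner_nonneg: "0 \<le> \<pi> \<bullet> w" if "0 \<le> w" for w :: "real ^ 'd"
    unfolding inner_vec_def using that \<pi>_pos
    by (intro sum_nonneg) (auto simp: less_eq_vec_def intro: mult_nonneg_nonneg less_imp_le)
  have AE_eq: "AE \<omega> in M. \<forall>k. y k \<omega> = \<pi> \<bullet> v k \<omega> \<and> \<alpha> k \<omega> = s / m * a k \<omega> \<and> \<beta> k \<omega> = s * b k \<omega>
      \<and> z k \<omega> = \<pi> \<bullet> (H k \<omega> *v u k \<omega>)"
    using data_nonneg \<pi>_le
  proof eventually_elim
    case (elim \<omega>)
    have "0 \<le> \<pi> \<bullet> (H k \<omega> *v u k \<omega>)" for k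
    proof -
      have "0 \<le> (\<pi> v* H k \<omega>) \<bullet> u k \<omega>"
        unfolding inner_vec_def using elim
        by (intro sum_nonneg) (auto simp: less_eq_vec_def intro: mult_nonneg_nonneg)
      then show ?thesis by (simp add: dot_lmul_matrix)
    qed
    then show ?case
      using elim by (simp add: y_def \<alpha>_def \<beta>_def z_def inner_nonneg max_absorb2)
  qed

  interpret almost_supermartingale M F y \<alpha> \<beta> z
  proof unfold_locales
    fix k and f :: "'w \<Rightarrow> ennreal" assume f: "f \<in> borel_measurable (F k)"
    define E where "E i = nn_cond_exp M (F k) (\<lambda>\<omega>. ennreal (v (Suc k) \<omega> $ i))" for i
    note [measurable] = f measurable_F_M[OF f] measurable_F_M[OF z_meas]
    have [measurable]: "(\<lambda>\<omega>. v (Suc k) \<omega> $ i) \<in> borel_measurable M" for i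
      by (rule measurable_compose[OF meas(1) borel_measurable_continuous_onI]) (intro continuous_intros)
    have [measurable]: "E i \<in> borel_measurable M" for i
      unfolding E_def by measurable
    have "(\<integral>\<^sup>+\<omega>. f \<omega> * ennreal (y (Suc k) \<omega> + z k \<omega>) \<partial>M)
        = (\<integral>\<^sup>+\<omega>. (\<Sum>i\<in>UNIV. (f \<omega> * ennreal (\<pi> $ i)) * ennreal (v (Suc k) \<omega> $ i)) + f \<omega> * ennreal (z k \<omega>) \<partial>M)"
    proof (rule nn_integral_cong_AE)
      show "AE \<omega> in M. f \<omega> * ennreal (y (Suc k) \<omega> + z k \<omega>)
        = (\<Sum>i\<in>UNIV. (f \<omega> * ennreal (\<pi> $ i)) * ennreal (v (Suc k) \<omega> $ i)) + f \<omega> * ennreal (z k \<omega>)"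
        using AE_eq data_nonneg
      proof eventually_elim
        case (elim \<omega>)
        have "ennreal (y (Suc k) \<omega>) = ennreal (\<pi> \<bullet> v (Suc k) \<omega>)"
          using elim by simp
        also have "\<dots> = (\<Sum>i\<in>UNIV. ennreal (\<pi> $ i) * ennreal (v (Suc k) \<omega> $ i))"
          using elim \<pi>_pos by (intro ennreal_inner) (auto simp: less_eq_vec_def less_imp_le)
        finally show ?case
          by (simp add: ennreal_plus y_def z_def distrib_left sum_distrib_left mult.assoc)
      qed
    qed
    also have "\<dots> = (\<Sum>i\<in>UNIV. \<integral>\<^sup>+\<omega>. (f \<omega> * ennreal (\<pi> $ i)) * ennreal (v (Suc k) \<omega> $ i) \<partial>M)
        + (\<integral>\<^sup>+\<omega>. f \<omega> * ennreal (z k \<omega>) \<partial>M)"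
      by (subst nn_integral_add) (auto simp: nn_integral_sum)
    \<comment> \<open>The test function \<open>f\<close> times a constant weight is known at time
      \<open>k\<close>, so each entry of \<open>v (Suc k)\<close> may be replaced by its conditional
      expectation.\<close>
    also have "\<dots> = (\<Sum>i\<in>UNIV. \<integral>\<^sup>+\<omega>. (f \<omega> * ennreal (\<pi> $ i)) * E i \<omega> \<partial>M)
        + (\<integral>\<^sup>+\<omega>. f \<omega> * ennreal (z k \<omega>) \<partial>M)"
      unfolding E_def by (subst cond.nn_cond_exp_intg) auto
    also have "\<dots> = (\<integral>\<^sup>+\<omega>. (\<Sum>i\<in>UNIV. (f \<omega> * ennreal (\<pi> $ i)) * E i \<omega>) + f \<omega> * ennreal (z k \<omega>) \<partial>M)"
      by (subst nn_integral_add) (auto simp: nn_integral_sum)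
    also have "\<dots> \<le> (\<integral>\<^sup>+\<omega>. f \<omega> * ennreal ((1 + \<alpha> k \<omega>) * y k \<omega> + \<beta> k \<omega>) \<partial>M)"
    proof (rule nn_integral_mono_AE)
      show "AE \<omega> in M. (\<Sum>i\<in>UNIV. (f \<omega> * ennreal (\<pi> $ i)) * E i \<omega>) + f \<omega> * ennreal (z k \<omega>)
        \<le> f \<omega> * ennreal ((1 + \<alpha> k \<omega>) * y k \<omega> + \<beta> k \<omega>)"
        using AE_eq data_nonneg \<pi>_le cond
      proof eventually_elim
        case (elim \<omega>)
        define w where "w = (V k \<omega> + a k \<omega> *\<^sub>R (\<chi> i j. 1)) *v v k \<omega>
          + b k \<omega> *\<^sub>R (\<chi> i. 1) - H k \<omega> *v u k \<omega>"
        have E_le: "enn2ereal (E i \<omega>) \<le> ereal (w $ i)" for i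
          using elim(4) by (simp add: nonneg_cond_exp_vec_def E_def w_def)
        \<comment> \<open>The right-hand side of the hypothesis dominates a nonnegative conditional
          expectation, so converting it to \<open>ennreal\<close> truncates nothing.\<close>
        have w: "0 \<le> w $ i" for i
          using order_trans[OF enn2ereal_nonneg E_le[of i]] by simp
        have E_le': "E i \<omega> \<le> ennreal (w $ i)" for i
          using E_le[of i] w[of i] by (simp add: less_eq_ennreal.rep_eq)
        have "(\<Sum>i\<in>UNIV. ennreal (\<pi> $ i) * E i \<omega>) \<le> (\<Sum>i\<in>UNIV. ennreal (\<pi> $ i) * ennreal (w $ i))"
          by (intro sum_mono mult_left_mono E_le') auto
        also have "\<dots> = ennreal (\<pi> \<bullet> w)"
          using w \<pi>_pos by (intro ennreal_inner[symmetric]) (auto simp: less_imp_le)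
        finally have "(\<Sum>i\<in>UNIV. ennreal (\<pi> $ i) * E i \<omega>) + ennreal (z k \<omega>)
            \<le> ennreal (\<pi> \<bullet> w) + ennreal (z k \<omega>)"
          by (rule add_right_mono)
        also have "\<dots> = ennreal (\<pi> \<bullet> w + z k \<omega>)"
          using w by (intro ennreal_plus[symmetric] inner_nonneg) (auto simp: less_eq_vec_def z_def)
        \<comment> \<open>Adding \<open>z k\<close> cancels the subtracted term in
          \<open>inner_step_le\<close>.\<close>
        also have "\<dots> \<le> ennreal ((1 + \<alpha> k \<omega>) * y k \<omega> + \<beta> k \<omega>)"
          using inner_step_le[OF m, of "v k \<omega>" "a k \<omega>" "V k \<omega>" "b k \<omega>" "H k \<omega> *v u k \<omega>"] elim
          by (intro ennreal_leI) (simp add: w_def s_def)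
        finally have "f \<omega> * ((\<Sum>i\<in>UNIV. ennreal (\<pi> $ i) * E i \<omega>) + ennreal (z k \<omega>))
            \<le> f \<omega> * ennreal ((1 + \<alpha> k \<omega>) * y k \<omega> + \<beta> k \<omega>)"
          by (rule mult_left_mono) simp
        then show ?case
          by (simp add: distrib_left sum_distrib_left mult.assoc)
      qed
    qed
    finally show "(\<integral>\<^sup>+\<omega>. f \<omega> * ennreal (y (Suc k) \<omega> + z k \<omega>) \<partial>M)
      \<le> (\<integral>\<^sup>+\<omega>. f \<omega> * ennreal ((1 + \<alpha> k \<omega>) * y k \<omega> + \<beta> k \<omega>) \<partial>M)" .
  qed (use s m in \<open>auto simp: y_meas \<alpha>_meas \<beta>_meas z_meas y_def \<alpha>_def \<beta>_def z_def\<close>)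

  have "AE \<omega> in M. convergent (\<lambda>k. y k \<omega>) \<and> summable (\<lambda>k. z k \<omega>)"
  proof (rule robbins_siegmund)
    show "AE \<omega> in M. summable (\<lambda>k. \<alpha> k \<omega>)"
      using AE_eq sum_a by eventually_elim (simp add: summable_mult)
    show "AE \<omega> in M. summable (\<lambda>k. \<beta> k \<omega>)"
      using AE_eq sum_b by eventually_elim (simp add: summable_mult)
  qed
  with AE_eq have conv: "AE \<omega> in M. convergent (\<lambda>k. \<pi> \<bullet> v k \<omega>)"
    and summ: "AE \<omega> in M. summable (\<lambda>k. \<pi> \<bullet> (H k \<omega> *v u k \<omega>))"
    by (auto elim: eventually_elim2)
  \<comment> \<open>Only the weighted sums are known to converge; the multiple of
    \<open>\<pi>\<close> with the right inner product represents their limit.\<close>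
  define v_lim where "v_lim \<omega> = (lim (\<lambda>k. \<pi> \<bullet> v k \<omega>) / (\<pi> \<bullet> \<pi>)) *\<^sub>R \<pi>" for \<omega>
  have "\<pi> \<noteq> 0"
    using \<pi>_pos[of undefined] by auto
  then have v_lim: "\<pi> \<bullet> v_lim \<omega> = lim (\<lambda>k. \<pi> \<bullet> v k \<omega>)" for \<omega>
    by (simp add: v_lim_def)
  have "v_lim \<in> borel_measurable M"
    unfolding v_lim_def by measurable
  moreover have "AE \<omega> in M. 0 \<le> \<pi> \<bullet> v_lim \<omega> \<and> (\<lambda>k. \<pi> \<bullet> v k \<omega>) \<longlonglongrightarrow> \<pi> \<bullet> v_lim \<omega>"
    using conv data_nonneg
  proof eventually_elim
    case (elim \<omega>)
    then have "(\<lambda>k. \<pi> \<bullet> v k \<omega>) \<longlonglongrightarrow> \<pi> \<bullet> v_lim \<omega>"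
      by (simp add: v_lim convergent_LIMSEQ_iff)
    moreover from this have "0 \<le> \<pi> \<bullet> v_lim \<omega>"
      by (rule LIMSEQ_le_const) (use elim in \<open>auto intro: inner_nonneg\<close>)
    ultimately show ?case by blast
  qed
  moreover have "AE \<omega> in M. bounded (range (\<lambda>k. v k \<omega>))"
    using conv data_nonneg
  proof eventually_elim
    case (elim \<omega>)
    obtain K where "\<And>k. \<pi> \<bullet> v k \<omega> \<le> K"
      using convergent_imp_Bseq[OF elim(1)] by (auto simp: Bseq_def abs_le_iff)
    then show ?case
      using elim(2) by (intro bounded_if_inner_le[OF \<pi>_pos]) auto
  qed
  ultimately show ?thesis
    using summ by blast
qed

end
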